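(* Let $d, n \geq 1$ be integers. For every non-empty inclusion-free hypergraph $H$ on vertex set $[n]$ and every function $f: H \to \mathbb{R}$, the number of weight assignments $w \in [d]^n$ that are isolating for $H, f$ is at least $$n\sum_{j=0}^{d-1} j^{n-1}.$$ Moreover, this bound is tight for every $d, n$: it is attained with equality by the singleton hypergraph $\{\{1\},\ldots,\{n\}\}$ with $f(e)=0$ for all edges $e$.
   Context: For a positive integer $m$, $[m]=\{1,\ldots,m\}$. A hypergraph $H$ on vertex set $[n]$ is a set of subsets of $[n]$, called edges; it is inclusion-free if no edge is a proper subset of another edge. A weight assignment $w \in [d]^n$ is a function $w:[n]\to[d]$. Given $f: H\to\mathbb{R}$ and $w$, the weight of an edge $e \in H$ is $fw(e) := f(e)+\sum_{i\in e} w(i)$. The weight assignment $w$ is isolating for $H, f$ if there is exactly one edge $e\in H$ with $fw(e)\le fw(h)$ for all $h\in H$ (i.e. exactly one minimum-weight edge). The convention $0^0=1$ is used. *)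

theory Defs
  imports Complex_Main "HOL-Library.FuncSet"
begin

definition hypergraph_on :: "nat \<Rightarrow> nat set set \<Rightarrow> bool" where
  "hypergraph_on n H \<longleftrightarrow> H \<subseteq> Pow {1..n}"

definition inclusion_free :: "'a set set \<Rightarrow> bool" where
  "inclusion_free H \<longleftrightarrow> (\<forall>e\<in>H. \<forall>h\<in>H. \<not> e \<subset> h)"

(* The extensional function space has exactly d ^ n elements, one for each map [n] to [d]. *)
definition weight_assignments :: "nat \<Rightarrow> nat \<Rightarrow> (nat \<Rightarrow> nat) set" where
  "weight_assignments n d = {1..n} \<rightarrow>\<^sub>E {1..d}"

definition edge_weight :: "('a set \<Rightarrow> real) \<Rightarrow> ('a \<Rightarrow> nat) \<Rightarrow> 'a set \<Rightarrow> real" where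
  "edge_weight f w e = f e + (\<Sum>i\<in>e. real (w i))"

(* f is total, but only its values on the edges of H matter. *)
definition isolating :: "'a set set \<Rightarrow> ('a set \<Rightarrow> real) \<Rightarrow> ('a \<Rightarrow> nat) \<Rightarrow> bool" where
  "isolating H f w \<longleftrightarrow>
     (\<exists>!e. e \<in> H \<and> (\<forall>h\<in>H. edge_weight f w e \<le> edge_weight f w h))"

definition singleton_hypergraph :: "nat \<Rightarrow> nat set set" where
  "singleton_hypergraph n = (\<lambda>i. {i}) ` {1..n}"

end

theory Submission
  imports Defs
begin

text \<open>
  Split the cube by the minimum of the weights. After a translation it suffices to show that among the
  functions \<^term>\<open>w \<in> V \<rightarrow>\<^sub>E {0..D}\<close> with minimum \<^term>\<open>0::nat\<close> at least \<open>n * D ^ (n - 1)\<close> are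
  isolating. That number is the volume of the real shell \<open>min w = 0\<close> in \<open>[0, D]\<^sup>n\<close>, which consists of
  \<open>n\<close> faces \<open>w i = 0\<close> and is covered by the closed cells \<open>C e\<close> on which \<open>e\<close> has minimum weight. So it
  suffices to bound the volume of \<open>C e\<close> within the shell by the number of lattice points of the
  shell that are interior to \<open>C e\<close>.

  Rounding the weights down on \<open>e\<close> and up off \<open>e\<close> moves a point of \<open>C e\<close> into the interior. On a face
  with \<open>i \<notin> e\<close> this is injective up to unit cells, and yields lattice points whose only zero off \<open>e\<close>
  is \<open>i\<close>. On a face with \<open>i \<in> e\<close> it yields lattice points all of whose zeros lie in \<open>e\<close>, but a point
  with \<open>z\<close> zeros is reached from \<open>z\<close> faces, so each face may only use the share \<open>1 / z\<close> of it. Here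
  the fractional parts off \<open>e\<close> are first replaced by one common slack \<open>u\<close>, which can only enlarge the
  volume, and then the coordinates \<open>x\<close> in \<open>e\<close> are replaced one after the other by \<open>\<lfloor>x + u\<rfloor>\<close>.
  Averaged over \<open>u\<close>, this again only enlarges the volume, and the value \<open>0\<close> is taken \<open>z - 1\<close> times
  with probability \<open>(1 - u) ^ (z - 1)\<close>, which has mean \<open>1 / z\<close>.

  Volumes are replaced by numbers of points of a grid of mesh \<open>1 / K\<close>, which costs a factor
  \<open>1 + n / K\<close> that disappears for large \<open>K\<close> because both sides are integers.
\<close>

section \<open>Rounding\<close>

text \<open>The number of \<^term>\<open>x::nat\<close> with \<^term>\<open>(x + u) div K = n\<close>, for \<^term>\<open>u \<le> K\<close>.\<close>

definition cell_size :: "nat \<Rightarrow> nat \<Rightarrow> nat \<Rightarrow> nat" where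
  "cell_size K u n = (if n = 0 then K - u else K)"

lemma sum_cell_size:
  assumes "u \<le> K"
  shows "(\<Sum>n\<le>p. cell_size K u n) = K * Suc p - u"
  using assms by (induction p) (auto simp: cell_size_def)

text \<open>
  The gain \<open>\<delta> u\<close> of the right-hand side sums to zero over \<^term>\<open>u < K\<close> and is positive first, negative
  later; a decreasing weight \<^term>\<open>h\<close> therefore makes the total gain nonnegative.
\<close>

lemma rounding_step:
  fixes h :: "nat \<Rightarrow> real"
  assumes K: "K > 0"
    and anti: "\<And>u u'. u \<le> u' \<Longrightarrow> u' < K \<Longrightarrow> h u' \<le> h u"
    and nonneg: "\<And>u. h u \<ge> 0"
    and down: "\<And>s s'. R s \<Longrightarrow> s' \<le> s \<Longrightarrow> R s'"
  shows "(\<Sum>u<K. h u * real (card {x. x < K * D \<and> R (x + u)}))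
       \<le> (\<Sum>u<K. h u * real (\<Sum>n\<le>D. if R (K * n + u) then cell_size K u n else 0))"
proof -
  \<comment> \<open>A downward closed \<open>R\<close> is a threshold \<open>s < a\<close> on the
    range \<open>s < K * Suc D\<close>, which contains every argument that occurs; the second
    disjunct below yields \<open>a = K * Suc D\<close> if \<open>R\<close> holds throughout.\<close>
  obtain a where aD: "a \<le> K * Suc D" and a: "\<And>s. s < K * Suc D \<Longrightarrow> R s \<longleftrightarrow> s < a"
  proof
    define a where "a = (LEAST s. \<not> R s \<or> s = K * Suc D)"
    have ex: "\<not> R a \<or> a = K * Suc D" unfolding a_def by (rule LeastI[of _ "K * Suc D"]) simp
    have least: "a \<le> s" if "\<not> R s \<or> s = K * Suc D" for s
      unfolding a_def by (rule Least_le) (rule that)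
    show "a \<le> K * Suc D" by (rule least) simp
    show "R s \<longleftrightarrow> s < a" if "s < K * Suc D" for s
      using ex least[of s] down[of s a] that by (metis linorder_not_less order.strict_iff_order)
  qed
  define p \<alpha> where "p = a div K" and "\<alpha> = a mod K"
  have a_eq: "a = K * p + \<alpha>" and \<alpha>K: "\<alpha> < K" using K by (auto simp: p_def \<alpha>_def)
  \<comment> \<open>Apart from \<open>p = 0\<close>, the right side will be
    \<open>K * Suc p - u\<close> for \<open>u < \<alpha>\<close> and \<open>K * p - u\<close>
    otherwise, against at most \<open>a - u\<close> on the left; \<open>\<delta> u\<close> is the
    difference.\<close>
  define \<delta> where "\<delta> u = (if u < \<alpha> then real K - real \<alpha> else - real \<alpha>)" for u
  have gap: "real (\<Sum>n\<le>D. if R (K * n + u) then cell_size K u n else 0)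
             - real (card {x. x < K * D \<and> R (x + u)}) \<ge> \<delta> u" if u: "u < K" for u
  proof -
    \<comment> \<open>Only an upper bound, since \<open>a - u\<close> may exceed
      \<open>K * D\<close>; the right side counts the topmost cell \<open>n = D\<close> with its
      full \<open>cell_size\<close>.\<close>
    have "{x. x < K * D \<and> R (x + u)} \<subseteq> {..<a - u}"
      using a u by (auto simp: less_diff_conv)
    then have left: "card {x. x < K * D \<and> R (x + u)} \<le> a - u"
      by (metis card_lessThan card_mono finite_lessThan)
    have lt: "K * n + u < K * Suc D" if "n \<le> D" for n
    proof -
      have "K * n \<le> K * D" using that by simp
      then show ?thesis using u by (simp add: add.commute add_less_le_mono)
    qed
    have right: "(\<Sum>n\<le>D. if R (K * n + u) then cell_size K u n else 0)
        = (\<Sum>n\<in>{n. n \<le> D \<and> K * n + u < a}. cell_size K u n)"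
      using a[OF lt] by (subst sum.inter_filter[symmetric]) (auto intro!: sum.cong simp: sum.inter_filter)
    have Dp: "p \<le> Suc D" using aD K by (metis a_eq add_leD1 nat_mult_le_cancel1)
    show ?thesis
    proof (cases "u < \<alpha>")
      case True
      have "p \<noteq> Suc D" using True aD a_eq by auto
      then have pD: "p \<le> D" using Dp by simp
      have "K * n + u < a \<longleftrightarrow> n \<le> p" for n
      proof
        assume *: "K * n + u < a"
        show "n \<le> p"
        proof (rule ccontr)
          assume "\<not> n \<le> p"
          then have "K * Suc p \<le> K * n" by (intro mult_le_mono) auto
          then show False using * a_eq \<alpha>K by simp
        qed
      next
        assume "n \<le> p"
        then have "K * n \<le> K * p" by simp
        then show "K * n + u < a" using True a_eq by linarith
      qed
      then have "{n. n \<le> D \<and> K * n + u < a} = {..p}" using pD by auto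
      then have "(\<Sum>n\<le>D. if R (K * n + u) then cell_size K u n else 0) = K * Suc p - u"
        using right sum_cell_size u by simp
      moreover have "u \<le> K * Suc p" using u by simp
      moreover have "u \<le> a" using True a_eq by simp
      then have "real (card {x. x < K * D \<and> R (x + u)}) \<le> real a - real u"
        using left by linarith
      ultimately show ?thesis using True a_eq by (simp add: \<delta>_def of_nat_diff algebra_simps)
    next
      case False
      have "K * n + u < a \<longleftrightarrow> n < p" if "n \<le> D" for n
      proof
        assume *: "K * n + u < a"
        show "n < p"
        proof (rule ccontr)
          assume "\<not> n < p"
          then have "K * p \<le> K * n" by (intro mult_le_mono) auto
          then show False using * a_eq False by linarith
        qed
      next
        assume "n < p"
        then have "K * Suc n \<le> K * p" by (intro mult_le_mono) auto
        then show "K * n + u < a" using u a_eq by simp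
      qed
      then have set: "{n. n \<le> D \<and> K * n + u < a} = {..<p}" using Dp by auto
      show ?thesis
      proof (cases p)
        case 0
        then have "a = \<alpha>" using a_eq by simp
        then have "card {x. x < K * D \<and> R (x + u)} = 0" using left False by linarith
        then show ?thesis using False by (simp only: \<delta>_def) (simp flip: of_nat_sum)
      next
        case (Suc q)
        then have "{..<p} = {..q}" by auto
        then have "(\<Sum>n\<le>D. if R (K * n + u) then cell_size K u n else 0) = K * p - u"
          using right set sum_cell_size u Suc by simp
        moreover have le: "u \<le> K * p" "u \<le> a" using u a_eq Suc by auto
        moreover have "real (card {x. x < K * D \<and> R (x + u)}) \<le> real a - real u"
          using left le by linarith
        ultimately show ?thesis using False a_eq by (simp add: \<delta>_def of_nat_diff algebra_simps)
      qed
    qed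
  qed
  have "(\<Sum>u<K. \<delta> u) = (\<Sum>u\<in>{..<\<alpha>}. real K - real \<alpha>) + (\<Sum>u\<in>{\<alpha>..<K}. - real \<alpha>)"
  proof -
    have "{..<K} = {..<\<alpha>} \<union> {\<alpha>..<K}" using \<alpha>K by auto
    then have "(\<Sum>u<K. \<delta> u) = (\<Sum>u\<in>{..<\<alpha>}. \<delta> u) + (\<Sum>u\<in>{\<alpha>..<K}. \<delta> u)"
      by (metis (no_types, lifting) \<open>\<alpha> < K\<close> finite_atLeastLessThan finite_lessThan ivl_disj_int_one(2) sum.union_disjoint)
    then show ?thesis by (simp add: \<delta>_def)
  qed
  also have "\<dots> = 0" using \<alpha>K by (simp add: of_nat_diff algebra_simps)
  \<comment> \<open>Comparison with the constant weight \<open>h \<alpha>\<close>, whose total gain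
    is 0: \<open>h u\<close> is at least \<open>h \<alpha>\<close> where the gain is positive and at
    most \<open>h \<alpha>\<close> elsewhere.\<close>
  finally have "0 = (\<Sum>u<K. h \<alpha> * \<delta> u)" by (simp flip: sum_distrib_left)
  also have "\<dots> \<le> (\<Sum>u<K. h u * \<delta> u)"
  proof (rule sum_mono)
    fix u assume "u \<in> {..<K}"
    then show "h \<alpha> * \<delta> u \<le> h u * \<delta> u"
      using anti[of u \<alpha>] anti[of \<alpha> u] \<alpha>K
      by (auto simp: \<delta>_def intro: mult_right_mono mult_right_mono_neg)
  qed
  also have "\<dots> \<le> (\<Sum>u<K. h u * (real (\<Sum>n\<le>D. if R (K * n + u) then cell_size K u n else 0)
             - real (card {x. x < K * D \<and> R (x + u)})))"
    using gap nonneg by (intro sum_mono mult_left_mono) auto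
  finally show ?thesis by (simp add: right_diff_distrib sum_subtractf)
qed

lemma sum_PiE_insert:
  assumes "t \<notin> T"
  shows "(\<Sum>x\<in>insert t T \<rightarrow>\<^sub>E S. F x) = (\<Sum>s\<in>S. \<Sum>x\<in>T \<rightarrow>\<^sub>E S. F (x(t := s)))"
proof -
  have "(\<Sum>x\<in>insert t T \<rightarrow>\<^sub>E S. F x) = (\<Sum>z\<in>S \<times> (T \<rightarrow>\<^sub>E S). F ((snd z)(t := fst z)))"
    unfolding PiE_insert_eq
    using assms inj_combinator[of t T "\<lambda>_. S"]
    by (subst sum.reindex) (auto simp: case_prod_unfold o_def)
  then show ?thesis by (simp add: sum.cartesian_product case_prod_unfold)
qed

lemma sum_fun_upd_inter:
  assumes "finite T" "t \<notin> T"
  shows "(\<Sum>j\<in>insert t T \<inter> A. real ((x(t := s)) j)) = (\<Sum>j\<in>T \<inter> A. real (x j)) + (if t \<in> A then real s else 0)"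
proof -
  have "(\<Sum>j\<in>T \<inter> A. real ((x(t := s)) j)) = (\<Sum>j\<in>T \<inter> A. real (x j))"
    using assms by (intro sum.cong) auto
  then show ?thesis using assms by (auto simp: Int_insert_left)
qed

lemma card_eq_sum_indicator:
  "finite S \<Longrightarrow> real (card {x \<in> S. P x}) = (\<Sum>x\<in>S. if P x then 1 else 0)"
  by (simp add: sum.If_cases Int_def)

text \<open>One coordinate at a time is replaced by \<open>(x + u) div K\<close>, where
  \<open>cell_size\<close> counts the preimages. The thresholds \<open>a\<close> stay arbitrary in
  the induction so that they can absorb the coordinate held fixed. The product of the earlier cell
  sizes decreases in \<open>u\<close>, which makes it an admissible weight for
  \<open>rounding_step\<close>.\<close>

lemma rounding:
  fixes A :: "'c \<Rightarrow> 'a set" and a :: "'c \<Rightarrow> real"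
  assumes K: "K > 0" and "finite T"
  shows "(\<Sum>u<K. \<Sum>x\<in>T \<rightarrow>\<^sub>E {..<K * D}. if \<forall>c\<in>C. (\<Sum>j\<in>T \<inter> A c. real (x j)) + real u < a c then 1 else 0)
       \<le> (\<Sum>u<K. \<Sum>n\<in>T \<rightarrow>\<^sub>E {..D}. if \<forall>c\<in>C. real K * (\<Sum>j\<in>T \<inter> A c. real (n j)) + real u < a c
              then real (\<Prod>j\<in>T. cell_size K u (n j)) else 0)"
  using \<open>finite T\<close>
proof (induction T arbitrary: a rule: finite_induct)
  case empty
  show ?case unfolding PiE_empty_domain by (intro sum_mono) auto
next
  case (insert t T)
  have fin: "finite (T \<rightarrow>\<^sub>E {..D})" using insert by (simp add: finite_PiE)
  have "(\<Sum>u<K. \<Sum>x\<in>insert t T \<rightarrow>\<^sub>E {..<K * D}. if \<forall>c\<in>C. (\<Sum>j\<in>insert t T \<inter> A c. real (x j)) + real u < a c then 1 else 0)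
    = (\<Sum>u<K. \<Sum>s<K * D. \<Sum>x\<in>T \<rightarrow>\<^sub>E {..<K * D}. if \<forall>c\<in>C. (\<Sum>j\<in>T \<inter> A c. real (x j)) + real u < a c - (if t \<in> A c then real s else 0) then 1 else (0::real))"
    unfolding sum_PiE_insert[OF insert.hyps(2)] sum_fun_upd_inter[OF insert.hyps]
    by (intro sum.cong refl if_cong) (auto simp: algebra_simps)
  \<comment> \<open>With the new coordinate \<open>s\<close> fixed outermost, the induction
    hypothesis rounds the others; afterwards their rounded values \<open>n\<close> are fixed and
    \<open>s\<close> is rounded.\<close>
  also have "\<dots> = (\<Sum>s<K * D. \<Sum>u<K. \<Sum>x\<in>T \<rightarrow>\<^sub>E {..<K * D}. if \<forall>c\<in>C. (\<Sum>j\<in>T \<inter> A c. real (x j)) + real u < a c - (if t \<in> A c then real s else 0) then 1 else (0::real))"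
    by (rule sum.swap)
  also have "\<dots> \<le> (\<Sum>s<K * D. \<Sum>u<K. \<Sum>n\<in>T \<rightarrow>\<^sub>E {..D}. if \<forall>c\<in>C. real K * (\<Sum>j\<in>T \<inter> A c. real (n j)) + real u < a c - (if t \<in> A c then real s else 0)
              then real (\<Prod>j\<in>T. cell_size K u (n j)) else 0)"
    by (intro sum_mono insert.IH)
  also have "\<dots> = (\<Sum>n\<in>T \<rightarrow>\<^sub>E {..D}. \<Sum>u<K. \<Sum>s<K * D. if \<forall>c\<in>C. real K * (\<Sum>j\<in>T \<inter> A c. real (n j)) + real u < a c - (if t \<in> A c then real s else 0)
              then real (\<Prod>j\<in>T. cell_size K u (n j)) else 0)"
    by (subst sum.swap, rule trans[OF sum.cong[OF refl sum.swap]], subst sum.swap, rule refl)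
  also have "\<dots> \<le> (\<Sum>n\<in>T \<rightarrow>\<^sub>E {..D}. \<Sum>u<K. \<Sum>s\<le>D. if \<forall>c\<in>C. real K * (\<Sum>j\<in>T \<inter> A c. real (n j)) + real u < a c - (if t \<in> A c then real (K * s) else 0)
              then real (\<Prod>j\<in>T. cell_size K u (n j)) * real (cell_size K u s) else 0)"
  proof (rule sum_mono)
    fix n assume "n \<in> T \<rightarrow>\<^sub>E {..D}"
    \<comment> \<open>Constraints without \<open>t\<close> restrict \<open>u\<close> alone and go
      into the weight \<open>h\<close>; those with \<open>t\<close> see only \<open>s + u\<close>
      and form the downward closed \<open>R\<close>.\<close>
    define b where "b c = a c - real K * (\<Sum>j\<in>T \<inter> A c. real (n j))" for c
    define h where "h u = (if \<forall>c\<in>C. t \<notin> A c \<longrightarrow> real u < b c then real (\<Prod>j\<in>T. cell_size K u (n j)) else 0)" for u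
    define R where "R s \<longleftrightarrow> (\<forall>c\<in>C. t \<in> A c \<longrightarrow> real s < b c)" for s :: nat
    have split: "(\<forall>c\<in>C. real K * (\<Sum>j\<in>T \<inter> A c. real (n j)) + real u < a c - (if t \<in> A c then real s else 0))
        \<longleftrightarrow> (\<forall>c\<in>C. t \<notin> A c \<longrightarrow> real u < b c) \<and> R (s + u)" for u s
      unfolding R_def b_def by (auto simp: algebra_simps)
    have "(\<Sum>u<K. h u * real (card {x. x < K * D \<and> R (x + u)}))
       \<le> (\<Sum>u<K. h u * real (\<Sum>n\<le>D. if R (K * n + u) then cell_size K u n else 0))"
    proof (rule rounding_step[OF K])
      fix u u' :: nat assume u: "u \<le> u'" "u' < K"
      have "(\<Prod>j\<in>T. cell_size K u' (n j)) \<le> (\<Prod>j\<in>T. cell_size K u (n j))"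
        using u by (intro prod_mono) (auto simp: cell_size_def)
      then have "real (\<Prod>j\<in>T. cell_size K u' (n j)) \<le> real (\<Prod>j\<in>T. cell_size K u (n j))"
        by (rule of_nat_mono)
      moreover have "\<forall>c\<in>C. t \<notin> A c \<longrightarrow> real u < b c" if "\<forall>c\<in>C. t \<notin> A c \<longrightarrow> real u' < b c"
        using that u by force
      ultimately show "h u' \<le> h u" unfolding h_def by (auto simp del: of_nat_prod)
    next
      fix s s' assume "R s" "s' \<le> s"
      then show "R s'" unfolding R_def by force
    qed (simp add: h_def del: of_nat_prod)
    moreover have "real (card {x. x < K * D \<and> R (x + u)}) = (\<Sum>s<K * D. if R (s + u) then 1 else 0)" for u
      using card_eq_sum_indicator[of "{..<K * D}" "\<lambda>x. R (x + u)"] by simp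
    ultimately have *: "(\<Sum>u<K. \<Sum>s<K * D. h u * (if R (s + u) then 1 else 0))
       \<le> (\<Sum>u<K. \<Sum>s\<le>D. h u * real (if R (K * s + u) then cell_size K u s else 0))"
      by (simp add: sum_distrib_left)
    have eq1: "(if (\<forall>c\<in>C. t \<notin> A c \<longrightarrow> real u < b c) \<and> R s then real (\<Prod>j\<in>T. cell_size K u (n j)) else 0)
        = h u * (if R s then 1 else 0)" for u s
      by (auto simp: h_def simp del: of_nat_prod)
    have eq2: "(if (\<forall>c\<in>C. t \<notin> A c \<longrightarrow> real u < b c) \<and> R s
          then real (\<Prod>j\<in>T. cell_size K u (n j)) * real (cell_size K u s') else 0)
        = h u * real (if R s then cell_size K u s' else 0)" for u s s'
      by (auto simp: h_def simp del: of_nat_prod)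
    show "(\<Sum>u<K. \<Sum>s<K * D. if \<forall>c\<in>C. real K * (\<Sum>j\<in>T \<inter> A c. real (n j)) + real u < a c - (if t \<in> A c then real s else 0)
              then real (\<Prod>j\<in>T. cell_size K u (n j)) else 0)
      \<le> (\<Sum>u<K. \<Sum>s\<le>D. if \<forall>c\<in>C. real K * (\<Sum>j\<in>T \<inter> A c. real (n j)) + real u < a c - (if t \<in> A c then real (K * s) else 0)
              then real (\<Prod>j\<in>T. cell_size K u (n j)) * real (cell_size K u s) else 0)"
      unfolding split eq1 eq2 by (rule *)
  qed
  also have "\<dots> = (\<Sum>u<K. \<Sum>s\<le>D. \<Sum>n\<in>T \<rightarrow>\<^sub>E {..D}. if \<forall>c\<in>C. real K * (\<Sum>j\<in>T \<inter> A c. real (n j)) + real u < a c - (if t \<in> A c then real (K * s) else 0)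
              then real (\<Prod>j\<in>T. cell_size K u (n j)) * real (cell_size K u s) else 0)"
    by (subst sum.swap, rule sum.cong[OF refl sum.swap])
  also have "\<dots> = (\<Sum>u<K. \<Sum>n\<in>insert t T \<rightarrow>\<^sub>E {..D}. if \<forall>c\<in>C. real K * (\<Sum>j\<in>insert t T \<inter> A c. real (n j)) + real u < a c
              then real (\<Prod>j\<in>insert t T. cell_size K u (n j)) else 0)"
  proof -
    have pr: "(\<Prod>j\<in>insert t T. cell_size K u ((n(t := s)) j)) = cell_size K u s * (\<Prod>j\<in>T. cell_size K u (n j))" for u n s
    proof -
      have "(\<Prod>j\<in>T. cell_size K u ((n(t := s)) j)) = (\<Prod>j\<in>T. cell_size K u (n j))"
        using insert by (intro prod.cong) auto
      then show ?thesis using insert by simp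
    qed
    show ?thesis
      unfolding sum_PiE_insert[OF insert.hyps(2)] sum_fun_upd_inter[OF insert.hyps] pr
      by (intro sum.cong refl if_cong) (auto simp: algebra_simps)
  qed
  finally show ?case .
qed

text \<open>All constraints with a common variable reduce to the tightest one.\<close>

lemma common_threshold:
  fixes s :: "'c \<Rightarrow> real"
  assumes K: "K > 0" and fin: "finite B" "finite C" and \<beta>: "\<And>c. c \<in> C \<Longrightarrow> \<beta> c \<in> B"
  shows "K * card {v \<in> B \<rightarrow>\<^sub>E {..<K}. \<forall>c\<in>C. real (v (\<beta> c)) < s c}
       \<le> K ^ card B * card {u. u < K \<and> (\<forall>c\<in>C. real u < s c)}"
proof (cases "C = {}")
  case True
  then show ?thesis using fin by (simp add: card_PiE flip: lessThan_def)
next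
  case False
  then obtain c where c: "c \<in> C" "\<And>c'. c' \<in> C \<Longrightarrow> s c \<le> s c'"
    using ex_is_arg_min_if_finite[OF fin(2), of s] by (auto simp: is_arg_min_linorder)
  \<comment> \<open>All constraints but the tightest are dropped, so only the coordinate
    \<open>b\<close> remains restricted. For a single common \<open>u\<close> the tightest
    constraint implies the others, so nothing is lost on the right.\<close>
  define b Q where "b = \<beta> c" and "Q = {u. u < K \<and> (\<forall>c\<in>C. real u < s c)}"
  have bB: "b \<in> B" using \<beta> c by (simp add: b_def)
  let ?S = "\<lambda>j. if j = b then Q else {..<K}"
  have "{v \<in> B \<rightarrow>\<^sub>E {..<K}. \<forall>c\<in>C. real (v (\<beta> c)) < s c} \<subseteq> PiE B ?S"
  proof
    fix v assume v: "v \<in> {v \<in> B \<rightarrow>\<^sub>E {..<K}. \<forall>c\<in>C. real (v (\<beta> c)) < s c}"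
    then have "real (v b) < s c" using c by (auto simp: b_def)
    then have "v b \<in> Q" using v c bB by (force simp: Q_def PiE_iff)
    then show "v \<in> PiE B ?S" using v by (auto simp: PiE_iff)
  qed
  then have "card {v \<in> B \<rightarrow>\<^sub>E {..<K}. \<forall>c\<in>C. real (v (\<beta> c)) < s c} \<le> card (PiE B ?S)"
    using fin by (intro card_mono finite_PiE) (auto simp: Q_def)
  also have "\<dots> = card Q * K ^ (card B - 1)"
  proof -
    have "(\<Prod>j\<in>B. card (?S j)) = card Q * (\<Prod>j\<in>B - {b}. card (?S j))"
      using fin bB by (subst prod.remove[of B b]) auto
    also have "(\<Prod>j\<in>B - {b}. card (?S j)) = (\<Prod>j\<in>B - {b}. K)"
      by (intro prod.cong) auto
    finally show ?thesis using fin bB by (simp add: card_PiE)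
  qed
  finally have "K * card {v \<in> B \<rightarrow>\<^sub>E {..<K}. \<forall>c\<in>C. real (v (\<beta> c)) < s c} \<le> K * (card Q * K ^ (card B - 1))"
    by simp
  also have "\<dots> = K ^ card B * card Q"
  proof -
    obtain l where "card B = Suc l" using fin bB by (metis card_Suc_Diff1)
    then show ?thesis by simp
  qed
  finally show ?thesis by (simp add: Q_def)
qed

text \<open>A discrete form of the integral of \<open>(1 - u) ^ z\<close> over the unit interval
  being \<open>1 / Suc z\<close>. The induction step needs \<open>Suc K ^ Suc z - K ^ Suc z\<close>
  to be at least \<open>Suc z * K ^ z\<close>, which follows by factoring the difference of
  powers.\<close>

lemma sum_power_le:
  "real (Suc z) * (\<Sum>u<K. real (K - u) ^ z) \<le> real K ^ Suc z + real (Suc z) * real K ^ z"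
proof (induction K)
  case 0
  show ?case by simp
next
  case (Suc K)
  have "(\<Sum>u<Suc K. real (Suc K - u) ^ z) = real (Suc K) ^ z + (\<Sum>u<K. real (K - u) ^ z)"
    by (subst sum.lessThan_Suc_shift) simp
  moreover have "real K ^ Suc z + real (Suc z) * real K ^ z \<le> real (Suc K) ^ Suc z"
  proof -
    have "real (Suc K) ^ Suc z - real K ^ Suc z
        = (real (Suc K) - real K) * (\<Sum>p<Suc z. real (Suc K) ^ p * real K ^ (z - p))"
      by (rule diff_power_eq_sum)
    also have "\<dots> = (\<Sum>p<Suc z. real (Suc K) ^ p * real K ^ (z - p))" by simp
    also have "\<dots> \<ge> (\<Sum>p<Suc z. real K ^ p * real K ^ (z - p))"
      by (intro sum_mono mult_right_mono power_mono) auto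
    also have "(\<Sum>p<Suc z. real K ^ p * real K ^ (z - p)) = (\<Sum>p<Suc z. real K ^ z)"
      by (intro sum.cong refl) (simp flip: power_add)
    finally show ?thesis by simp
  qed
  ultimately show ?case using Suc by (simp only: distrib_left)
qed

text \<open>The common vertices cancel. On what remains, rounding down on \<open>e\<close> and up
  off \<open>e\<close> favours \<open>e\<close> on both sides.\<close>

lemma edge_weight_le_iff:
  assumes "finite e" "finite h"
  shows "edge_weight f w e \<le> edge_weight f w h \<longleftrightarrow>
         f e + (\<Sum>j\<in>e - h. real (w j)) \<le> f h + (\<Sum>j\<in>h - e. real (w j))"
  using assms sum.Int_Diff[of e "\<lambda>j. real (w j)" h] sum.Int_Diff[of h "\<lambda>j. real (w j)" e]
  by (simp add: edge_weight_def Int_commute)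

lemma edge_weight_less_iff:
  assumes "finite e" "finite h"
  shows "edge_weight f w e < edge_weight f w h \<longleftrightarrow>
         f e + (\<Sum>j\<in>e - h. real (w j)) < f h + (\<Sum>j\<in>h - e. real (w j))"
  using edge_weight_le_iff[OF assms(2,1), of f w] by (simp add: not_le[symmetric])

lemma prod_cell_size:
  assumes "finite T"
  shows "(\<Prod>j\<in>T. cell_size K u (n j)) = (K - u) ^ card {j \<in> T. n j = 0} * K ^ (card T - card {j \<in> T. n j = 0})"
proof -
  have "(\<Prod>j\<in>T. cell_size K u (n j)) = (K - u) ^ card {j \<in> T. n j = 0} * K ^ card {j \<in> T. n j \<noteq> 0}"
    using assms by (simp add: cell_size_def prod.If_cases Int_def)
  moreover have "{j \<in> T. n j \<noteq> 0} = T - {j \<in> T. n j = 0}" by auto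
  ultimately show ?thesis using assms by (simp add: card_Diff_subset)
qed

text \<open>Each zero coordinate contributes \<open>K - u\<close> and every other one
  \<open>K\<close>, so \<open>sum_power_le\<close> applies. The extra 1 in \<open>Suc z\<close> will
  account for the zero at the face coordinate \<open>i\<close>, which is not in
  \<open>T\<close>.\<close>

lemma sum_prod_cell_size:
  fixes n :: "'a \<Rightarrow> nat"
  assumes "finite T" "K > 0"
  defines "z \<equiv> card {j \<in> T. n j = 0}"
  shows "(\<Sum>u<K. real (\<Prod>j\<in>T. cell_size K u (n j))) \<le> real K ^ Suc (card T) * (1 / real (Suc z) + 1 / real K)"
proof -
  define q where "q = card T - z"
  have q: "card T = z + q" unfolding q_def z_def using assms by (simp add: card_mono)
  have "(\<Sum>u<K. real (\<Prod>j\<in>T. cell_size K u (n j))) = real K ^ q * (\<Sum>u<K. real (K - u) ^ z)"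
    unfolding prod_cell_size[OF assms(1)] z_def[symmetric] q_def[symmetric]
    by (simp add: sum_distrib_left mult.commute)
  also have "\<dots> \<le> real K ^ q * (real K ^ Suc z / real (Suc z) + real K ^ z)"
  proof (rule mult_left_mono)
    have "(\<Sum>u<K. real (K - u) ^ z) \<le> (real K ^ Suc z + real (Suc z) * real K ^ z) / real (Suc z)"
      using sum_power_le[of z K] by (simp only: pos_le_divide_eq of_nat_0_less_iff zero_less_Suc mult.commute)
    then show "(\<Sum>u<K. real (K - u) ^ z) \<le> real K ^ Suc z / real (Suc z) + real K ^ z"
      by (simp add: add_divide_distrib)
  qed simp
  also have "\<dots> = real K ^ Suc (card T) * (1 / real (Suc z) + 1 / real K)"
    using assms(2) by (simp add: q power_add algebra_simps)
  finally show ?thesis .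
qed

section \<open>Lattice points of the shell\<close>

text \<open>\<open>D\<close> is the side of the cube and \<open>K\<close> the number of grid cells
  per unit length.\<close>

locale shell =
  fixes V :: "'a set" and H :: "'a set set" and f :: "'a set \<Rightarrow> real" and K D :: nat
  assumes finV: "finite V" and HV: "H \<subseteq> Pow V" and incl: "inclusion_free H" and K: "K > 0"
begin

definition isolated_by :: "'a set \<Rightarrow> ('a \<Rightarrow> nat) set" where
  "isolated_by e = {w \<in> V \<rightarrow>\<^sub>E {..D}. \<forall>h\<in>H. h \<noteq> e \<longrightarrow> edge_weight f w e < edge_weight f w h}"

definition zeros :: "('a \<Rightarrow> nat) \<Rightarrow> 'a set" where
  "zeros w = {j \<in> V. w j = 0}"

text \<open>
  The centre of a grid cell of the face \<open>w i = 0\<close>, scaled by \<^term>\<open>2 * K\<close> to stay within the natural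
  numbers. Centres rather than corners make every rounding strict.
\<close>

definition face_point :: "'a \<Rightarrow> ('a \<Rightarrow> nat) \<Rightarrow> 'a \<Rightarrow> nat" where
  "face_point i X j = (if j = i then 0 else 2 * X j + 1)"

definition face_cell :: "'a set \<Rightarrow> 'a \<Rightarrow> ('a \<Rightarrow> nat) set" where
  "face_cell e i = {X \<in> (V - {i}) \<rightarrow>\<^sub>E {..<K * D}.
     \<forall>h\<in>H. edge_weight (\<lambda>e. 2 * real K * f e) (face_point i X) e
         \<le> edge_weight (\<lambda>e. 2 * real K * f e) (face_point i X) h}"

lemma finite_edge: "e \<in> H \<Longrightarrow> finite e"
  using HV finV by (meson PowD finite_subset subsetD)

lemma finite_H: "finite H"
  using HV finV by (simp add: finite_subset)

lemma finite_isolated_by: "finite (isolated_by e)"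
  unfolding isolated_by_def using finV by (simp add: finite_PiE)

lemma finite_zeros: "finite (zeros w)"
  using finV by (simp add: zeros_def)

text \<open>Inclusion-freeness enters here. A vertex of \<open>e - h\<close> makes the rounding
  strict on outside faces, and a vertex of \<open>h - e\<close> carries the slack on inside
  faces.\<close>

lemma diff_nonempty: "e \<in> H \<Longrightarrow> h \<in> H \<Longrightarrow> h \<noteq> e \<Longrightarrow> e - h \<noteq> {}"
  using incl by (auto simp: inclusion_free_def)

lemma div_less: "x < K * D \<Longrightarrow> x div K < D"
  by (simp add: less_mult_imp_div_less mult.commute)

section \<open>The grid cells of one face that belong to one edge\<close>

text \<open>The rounded point \<open>\<rho> X\<close> together with the remainders
  \<open>\<sigma> X\<close> determines \<open>X\<close>, and there are
  \<open>K ^ (card V - 1)\<close> remainders. Coordinates rounded up are positive, so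
  \<open>i\<close> is the only zero off \<open>e\<close>.\<close>

lemma card_face_cell_outside:
  assumes e: "e \<in> H" and i: "i \<in> V - e"
  shows "card (face_cell e i) \<le> K ^ (card V - 1) * card {w \<in> isolated_by e. zeros w - e = {i}}"
proof -
  define \<rho> where "\<rho> X = (\<lambda>j\<in>V. if j = i then 0 else if j \<in> e then X j div K else X j div K + 1)" for X :: "'a \<Rightarrow> nat"
  define \<sigma> where "\<sigma> X = (\<lambda>j\<in>V - {i}. X j mod K)" for X :: "'a \<Rightarrow> nat"
  let ?W = "{w \<in> isolated_by e. zeros w - e = {i}}"
  have "inj_on (\<lambda>X. (\<rho> X, \<sigma> X)) (face_cell e i)"
  proof (rule inj_onI)
    fix X Y assume X: "X \<in> face_cell e i" and Y: "Y \<in> face_cell e i" and "(\<rho> X, \<sigma> X) = (\<rho> Y, \<sigma> Y)"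
    then have eq: "\<rho> X j = \<rho> Y j" "\<sigma> X j = \<sigma> Y j" for j by auto
    show "X = Y"
    proof (rule PiE_ext)
      show "X \<in> (V - {i}) \<rightarrow>\<^sub>E {..<K * D}" "Y \<in> (V - {i}) \<rightarrow>\<^sub>E {..<K * D}"
        using X Y by (auto simp: face_cell_def)
      fix j assume j: "j \<in> V - {i}"
      then have "X j div K = Y j div K" using eq(1)[of j] by (auto simp: \<rho>_def split: if_splits)
      moreover have "X j mod K = Y j mod K" using eq(2)[of j] j by (auto simp: \<sigma>_def)
      ultimately show "X j = Y j" by (metis div_mult_mod_eq)
    qed
  qed
  moreover have "(\<lambda>X. (\<rho> X, \<sigma> X)) ` face_cell e i \<subseteq> ?W \<times> ((V - {i}) \<rightarrow>\<^sub>E {..<K})"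
  proof (intro image_subsetI SigmaI)
    fix X assume X: "X \<in> face_cell e i"
    then have XD: "X j < K * D" if "j \<in> V" "j \<noteq> i" for j
      using that by (auto simp: face_cell_def PiE_iff)
    show "\<sigma> X \<in> (V - {i}) \<rightarrow>\<^sub>E {..<K}" using K by (auto simp: \<sigma>_def)
    have "\<rho> X \<in> V \<rightarrow>\<^sub>E {..D}"
      using div_less[OF XD] by (force simp: \<rho>_def)
    moreover have "edge_weight f (\<rho> X) e < edge_weight f (\<rho> X) h" if h: "h \<in> H" "h \<noteq> e" for h
    proof -
      have fin: "finite e" "finite h" using finite_edge e h by auto
      have V: "e \<subseteq> V" "h \<subseteq> V" using HV e h by auto
      have "2 * real K * f e + (\<Sum>j\<in>e - h. real (face_point i X j))
          \<le> 2 * real K * f h + (\<Sum>j\<in>h - e. real (face_point i X j))"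
        using X h edge_weight_le_iff[OF fin, of "\<lambda>e. 2 * real K * f e" "face_point i X"] by (simp add: face_cell_def)
      \<comment> \<open>The strict inequality must come from \<open>e - h\<close>: the set
        \<open>h - e\<close> may consist of \<open>i\<close> alone, where both values are 0. It
        holds because a centre lies strictly above the point below it.\<close>
      moreover have "(\<Sum>j\<in>e - h. real (2 * K * \<rho> X j)) < (\<Sum>j\<in>e - h. real (face_point i X j))"
      proof (rule sum_strict_mono)
        fix j assume j: "j \<in> e - h"
        have "K * (X j div K) \<le> X j" by simp
        then have "2 * K * (X j div K) < 2 * X j + 1" by linarith
        then have "2 * K * \<rho> X j < face_point i X j" using j i V by (auto simp: \<rho>_def face_point_def)
        then show "real (2 * K * \<rho> X j) < real (face_point i X j)" by (simp only: of_nat_less_iff)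
      qed (use fin e h diff_nonempty in auto)
      moreover have "(\<Sum>j\<in>h - e. real (face_point i X j)) \<le> (\<Sum>j\<in>h - e. real (2 * K * \<rho> X j))"
      proof (rule sum_mono)
        fix j assume j: "j \<in> h - e"
        have "X j < K * (X j div K + 1)" using K by (simp add: dividend_less_times_div)
        then have "2 * X j + 1 \<le> 2 * K * (X j div K + 1)" by linarith
        then have "face_point i X j \<le> 2 * K * \<rho> X j" using j i V by (auto simp: \<rho>_def face_point_def)
        then show "real (face_point i X j) \<le> real (2 * K * \<rho> X j)" by (simp only: of_nat_le_iff)
      qed
      ultimately have "2 * real K * f e + (\<Sum>j\<in>e - h. real (2 * K * \<rho> X j))
          < 2 * real K * f h + (\<Sum>j\<in>h - e. real (2 * K * \<rho> X j))" by linarith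
      then have "2 * real K * (f e + (\<Sum>j\<in>e - h. real (\<rho> X j))) < 2 * real K * (f h + (\<Sum>j\<in>h - e. real (\<rho> X j)))"
        by (simp add: sum_distrib_left distrib_left)
      then show ?thesis using K unfolding edge_weight_less_iff[OF fin] by simp
    qed
    moreover have "zeros (\<rho> X) - e = {i}" using i by (auto simp: zeros_def \<rho>_def split: if_splits)
    ultimately show "\<rho> X \<in> ?W" by (auto simp: isolated_by_def)
  qed
  ultimately have "card (face_cell e i) \<le> card (?W \<times> ((V - {i}) \<rightarrow>\<^sub>E {..<K}))"
    using finV finite_isolated_by by (intro card_inj_on_le) (auto simp: finite_PiE)
  also have "\<dots> = K ^ (card V - 1) * card ?W"
    using finV i by (simp add: card_cartesian_product card_PiE)
  finally show ?thesis .
qed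

text \<open>Off \<open>e\<close>, a coordinate splits into its integer part \<open>m\<close> and the
  slack \<open>v\<close> gained by rounding up; the coordinates \<open>x\<close> in \<open>e\<close>
  are kept. The slacks are then replaced by a common \<open>u\<close> through
  \<open>common_threshold\<close>, whose factor \<open>K\<close> appears on the left. The number
  \<open>a m h\<close> is the threshold with the coordinates off \<open>e\<close> rounded
  up.\<close>

lemma card_face_cell_inside_le:
  fixes a :: "('a \<Rightarrow> nat) \<Rightarrow> 'a set \<Rightarrow> real"
  assumes e: "e \<in> H" and i: "i \<in> e"
  defines "a \<equiv> \<lambda>m h. real K * (f h - f e + (\<Sum>j\<in>h - e. real (m j + 1)))"
  shows "real K * real (card (face_cell e i))
       \<le> real K ^ card (V - e) * (\<Sum>m\<in>(V - e) \<rightarrow>\<^sub>E {..<D}. \<Sum>u<K. \<Sum>x\<in>(e - {i}) \<rightarrow>\<^sub>E {..<K * D}.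
            if \<forall>h\<in>H - {e}. (\<Sum>j\<in>(e - {i}) \<inter> - h. real (x j)) + real u < a m h then 1 else 0)"
proof -
  \<comment> \<open>Of the slacks in \<open>h - e\<close> only the one at a chosen vertex
    \<open>\<beta> h\<close> is kept. This weakens the constraint to the form needed for
    \<open>common_threshold\<close>.\<close>
  define \<beta> where "\<beta> h = (SOME b. b \<in> h - e)" for h
  have \<beta>: "\<beta> h \<in> h - e" if "h \<in> H - {e}" for h
    unfolding \<beta>_def by (rule someI_ex) (use diff_nonempty[of h e] that e in auto)
  have eV: "e \<subseteq> V" using HV e by auto
  let ?M = "(V - e) \<rightarrow>\<^sub>E {..<D}" and ?X = "(e - {i}) \<rightarrow>\<^sub>E {..<K * D}"
  define s where "s m x h = a m h - (\<Sum>j\<in>(e - {i}) \<inter> - h. real (x j))" for m x h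
  define S where "S m x = {v \<in> (V - e) \<rightarrow>\<^sub>E {..<K}. \<forall>h\<in>H - {e}. real (v (\<beta> h)) < s m x h}" for m x
  define \<psi> where "\<psi> X = ((\<lambda>j\<in>V - e. X j div K), (restrict X (e - {i}), (\<lambda>j\<in>V - e. K - 1 - X j mod K)))" for X
  have finS: "finite (S m x)" for m x
    unfolding S_def using finV by (simp add: finite_PiE)
  have finX: "finite ?X" using finite_edge[OF e] by (simp add: finite_PiE)
  have finM: "finite ?M" using finV by (simp add: finite_PiE)
  have "inj_on \<psi> (face_cell e i)"
  proof (rule inj_onI)
    fix X Y assume X: "X \<in> face_cell e i" and Y: "Y \<in> face_cell e i" and eq: "\<psi> X = \<psi> Y"
    show "X = Y"
    proof (rule PiE_ext)
      show "X \<in> (V - {i}) \<rightarrow>\<^sub>E {..<K * D}" "Y \<in> (V - {i}) \<rightarrow>\<^sub>E {..<K * D}"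
        using X Y by (auto simp: face_cell_def)
      fix j assume j: "j \<in> V - {i}"
      show "X j = Y j"
      proof (cases "j \<in> e")
        case True
        have "restrict X (e - {i}) j = restrict Y (e - {i}) j" using eq by (simp add: \<psi>_def)
        then show ?thesis using True j by simp
      next
        case False
        have "(\<lambda>j\<in>V - e. X j div K) j = (\<lambda>j\<in>V - e. Y j div K) j"
          "(\<lambda>j\<in>V - e. K - 1 - X j mod K) j = (\<lambda>j\<in>V - e. K - 1 - Y j mod K) j"
          using eq by (simp_all only: \<psi>_def prod.inject)
        then have "X j div K = Y j div K" "K - 1 - X j mod K = K - 1 - Y j mod K"
          using False j by auto
        moreover have "X j mod K < K" "Y j mod K < K" using K by auto
        ultimately have "X j div K = Y j div K" "X j mod K = Y j mod K" by linarith+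
        then show ?thesis by (metis div_mult_mod_eq)
      qed
    qed
  qed
  moreover have "\<psi> ` face_cell e i \<subseteq> (SIGMA m:?M. SIGMA x:?X. S m x)"
  proof (rule image_subsetI)
    fix X assume X: "X \<in> face_cell e i"
    define m x v where "m = (\<lambda>j\<in>V - e. X j div K)" and "x = restrict X (e - {i})"
      and "v = (\<lambda>j\<in>V - e. K - 1 - X j mod K)"
    have XD: "X j < K * D" if "j \<in> V" "j \<noteq> i" for j
      using that X by (auto simp: face_cell_def PiE_iff)
    have m: "m \<in> ?M" using div_less[OF XD] i by (auto simp: m_def)
    have x: "x \<in> ?X" using XD eV by (auto simp: x_def)
    have "real (v (\<beta> h)) < s m x h" if h: "h \<in> H - {e}" for h
    proof -
      have fin: "finite e" "finite h" using finite_edge e h by auto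
      have hV: "h \<subseteq> V" using HV h by auto
      have "2 * real K * f e + (\<Sum>j\<in>e - h. real (face_point i X j))
          \<le> 2 * real K * f h + (\<Sum>j\<in>h - e. real (face_point i X j))"
        using X h edge_weight_le_iff[OF fin, of "\<lambda>e. 2 * real K * f e" "face_point i X"] by (simp add: face_cell_def)
      moreover have "2 * (\<Sum>j\<in>(e - {i}) \<inter> - h. real (x j)) \<le> (\<Sum>j\<in>e - h. real (face_point i X j))"
      proof -
        have "2 * (\<Sum>j\<in>(e - {i}) \<inter> - h. real (x j)) \<le> (\<Sum>j\<in>(e - {i}) \<inter> - h. real (face_point i X j))"
          unfolding sum_distrib_left by (rule sum_mono) (auto simp: face_point_def x_def)
        also have "\<dots> \<le> (\<Sum>j\<in>e - h. real (face_point i X j))"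
          using fin by (intro sum_mono2) auto
        finally show ?thesis .
      qed
      moreover have "(\<Sum>j\<in>h - e. real (face_point i X j)) + 2 * real (v (\<beta> h)) < 2 * real K * (\<Sum>j\<in>h - e. real (m j + 1))"
      proof -
        \<comment> \<open>In the scale \<open>2 * K\<close>, the centre lies
          \<open>2 * v j + 1\<close> below the rounded-up value; the summand 1 makes the inequality
          strict.\<close>
        have pt: "real (face_point i X j) + 2 * real (v j) + 1 = 2 * real K * real (m j + 1)" if "j \<in> h - e" for j
        proof -
          have j: "j \<in> V - e" "j \<noteq> i" using that hV i by auto
          have "X j mod K < K" using K by simp
          moreover have "X j = K * (X j div K) + X j mod K" by simp
          ultimately have "2 * X j + 1 + 2 * (K - 1 - X j mod K) + 1 = 2 * (K * (X j div K)) + 2 * K"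
            by linarith
          then have "face_point i X j + 2 * v j + 1 = 2 * K * (m j + 1)"
            using j by (simp add: face_point_def v_def m_def)
          then show ?thesis by (metis (mono_tags) of_nat_1 of_nat_add of_nat_mult of_nat_numeral)
        qed
        have "(\<Sum>j\<in>h - e. real (face_point i X j)) + 2 * real (v (\<beta> h)) + 1
            \<le> (\<Sum>j\<in>h - e. real (face_point i X j)) + (\<Sum>j\<in>h - e. 2 * real (v j) + 1)"
          using member_le_sum[of "\<beta> h" "h - e" "\<lambda>j. 2 * real (v j) + 1"] \<beta>[OF h] fin by simp
        also have "\<dots> = (\<Sum>j\<in>h - e. real (face_point i X j) + 2 * real (v j) + 1)"
          by (simp add: sum.distrib)
        also have "\<dots> = 2 * real K * (\<Sum>j\<in>h - e. real (m j + 1))"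
          unfolding sum_distrib_left by (intro sum.cong refl pt)
        finally show ?thesis by linarith
      qed
      moreover define r where "r = (\<Sum>j\<in>h - e. real (m j + 1))"
      ultimately have "(\<Sum>j\<in>(e - {i}) \<inter> - h. real (x j)) + real (v (\<beta> h)) < real K * f h - real K * f e + real K * r"
        unfolding r_def[symmetric] mult.assoc by linarith
      then show ?thesis unfolding s_def a_def r_def[symmetric] by (simp add: algebra_simps)
    qed
    moreover have "v \<in> (V - e) \<rightarrow>\<^sub>E {..<K}" using K by (auto simp: v_def)
    ultimately have "v \<in> S m x" by (simp add: S_def)
    then show "\<psi> X \<in> (SIGMA m:?M. SIGMA x:?X. S m x)"
      using m x by (simp add: \<psi>_def m_def x_def v_def)
  qed
  ultimately have "card (face_cell e i) \<le> card (SIGMA m:?M. SIGMA x:?X. S m x)"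
    using finM finX finS by (intro card_inj_on_le) auto
  also have "\<dots> = (\<Sum>m\<in>?M. \<Sum>x\<in>?X. card (S m x))"
    using finM finX finS by (simp add: card_SigmaI)
  finally have "K * card (face_cell e i) \<le> (\<Sum>m\<in>?M. \<Sum>x\<in>?X. K * card (S m x))"
    by (simp flip: sum_distrib_left)
  also have "\<dots> \<le> (\<Sum>m\<in>?M. \<Sum>x\<in>?X. K ^ card (V - e) * card {u. u < K \<and> (\<forall>h\<in>H - {e}. real u < s m x h)})"
  proof -
    have "\<beta> h \<in> V - e" if "h \<in> H - {e}" for h using \<beta>[OF that] HV that by auto
    then show ?thesis
      unfolding S_def by (intro sum_mono common_threshold K) (use finV finite_H in simp_all)
  qed
  finally have "real (K * card (face_cell e i))
      \<le> real (\<Sum>m\<in>?M. \<Sum>x\<in>?X. K ^ card (V - e) * card {u. u < K \<and> (\<forall>h\<in>H - {e}. real u < s m x h)})"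
    by (simp only: of_nat_le_iff)
  also have "\<dots> = real K ^ card (V - e) * (\<Sum>m\<in>?M. \<Sum>x\<in>?X. \<Sum>u<K. if \<forall>h\<in>H - {e}. real u < s m x h then 1 else 0)"
    using card_eq_sum_indicator[of "{..<K}" "\<lambda>u. \<forall>h\<in>H - {e}. real u < s _ _ h"]
    by (simp add: sum_distrib_left)
  also have "(\<Sum>m\<in>?M. \<Sum>x\<in>?X. \<Sum>u<K. if \<forall>h\<in>H - {e}. real u < s m x h then 1 else (0::real))
      = (\<Sum>m\<in>?M. \<Sum>u<K. \<Sum>x\<in>?X. if \<forall>h\<in>H - {e}. real u < s m x h then 1 else 0)"
    by (intro sum.cong refl sum.swap)
  finally show ?thesis by (simp add: s_def less_diff_eq add.commute)
qed

text \<open>After \<open>rounding\<close> on \<open>e - {i}\<close>, the rounded values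
  \<open>n\<close>, the value 0 at \<open>i\<close> and the values \<open>m + 1\<close> off
  \<open>e\<close> form one lattice point \<open>pt (m, n)\<close>. Its zeros lie in
  \<open>e\<close> because \<open>m + 1\<close> is positive.\<close>

lemma card_face_cell_inside:
  assumes e: "e \<in> H" and i: "i \<in> e"
  shows "real (card (face_cell e i))
       \<le> real K ^ (card V - 1) * (\<Sum>w | w \<in> isolated_by e \<and> i \<in> zeros w \<and> zeros w \<subseteq> e. 1 / real (card (zeros w)) + 1 / real K)"
proof -
  define a where "a m h = real K * (f h - f e + (\<Sum>j\<in>h - e. real (m j + 1)))" for m :: "'a \<Rightarrow> nat" and h
  let ?M = "(V - e) \<rightarrow>\<^sub>E {..<D}" and ?N = "(e - {i}) \<rightarrow>\<^sub>E {..D}"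
  let ?W = "{w. w \<in> isolated_by e \<and> i \<in> zeros w \<and> zeros w \<subseteq> e}"
  let ?\<omega> = "\<lambda>w. 1 / real (card (zeros w)) + 1 / real K"
  define pt where "pt = (\<lambda>(m, n). \<lambda>j\<in>V. if j = i then 0 else if j \<in> e then n j else m j + 1 :: nat)"
  have eV: "e \<subseteq> V" using HV e by auto
  have fine: "finite e" using finite_edge e .
  have finM: "finite ?M" using finV by (simp add: finite_PiE)
  have finN: "finite ?N" using fine by (simp add: finite_PiE)
  have finW: "finite ?W" using finite_isolated_by by simp
  have zeros_pt: "zeros (pt (m, n)) = insert i {j \<in> e - {i}. n j = 0}" for m n
    using eV i by (auto simp: zeros_def pt_def split: if_splits)
  \<comment> \<open>A single admissible slack suffices: as \<open>u\<close> is nonnegative, the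
    constraint without it is still strict.\<close>
  have iso: "pt (m, n) \<in> ?W"
    if m: "m \<in> ?M" and n: "n \<in> ?N"
      and lt: "\<forall>h\<in>H - {e}. real K * (\<Sum>j\<in>(e - {i}) \<inter> - h. real (n j)) + real u < a m h" for m n u
  proof -
    have "pt (m, n) \<in> V \<rightarrow>\<^sub>E {..D}"
      using m n eV by (fastforce simp: pt_def PiE_iff Suc_le_eq)
    moreover have "edge_weight f (pt (m, n)) e < edge_weight f (pt (m, n)) h" if h: "h \<in> H" "h \<noteq> e" for h
    proof -
      have fin: "finite e" "finite h" using finite_edge e h by auto
      have hV: "h \<subseteq> V" using HV h by auto
      have "(\<Sum>j\<in>e - h. real (pt (m, n) j)) = (\<Sum>j\<in>(e - {i}) \<inter> - h. real (n j))"
        using fin eV by (intro sum.mono_neutral_cong_right) (auto simp: pt_def)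
      moreover have "(\<Sum>j\<in>h - e. real (pt (m, n) j)) = (\<Sum>j\<in>h - e. real (m j + 1))"
        using hV i by (intro sum.cong) (auto simp: pt_def)
      moreover have "real K * (\<Sum>j\<in>(e - {i}) \<inter> - h. real (n j)) < a m h" using lt h by force
      ultimately show ?thesis
        using K unfolding edge_weight_less_iff[OF fin] a_def by simp
    qed
    ultimately have "pt (m, n) \<in> isolated_by e" by (auto simp: isolated_by_def)
    then show ?thesis using i by (auto simp: zeros_pt)
  qed
  \<comment> \<open>For points of \<open>?W\<close> the constraint on \<open>u\<close> is dropped
    and all slacks are counted, which gives the share \<open>1 / card (zeros w)\<close>; for other
    points no slack is admissible, by \<open>iso\<close>.\<close>
  have bound: "(\<Sum>u<K. if \<forall>h\<in>H - {e}. real K * (\<Sum>j\<in>(e - {i}) \<inter> - h. real (n j)) + real u < a m h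
              then real (\<Prod>j\<in>e - {i}. cell_size K u (n j)) else 0)
      \<le> (if pt (m, n) \<in> ?W then real K ^ card e * ?\<omega> (pt (m, n)) else 0)"
    if m: "m \<in> ?M" and n: "n \<in> ?N" for m n
  proof (cases "pt (m, n) \<in> ?W")
    case True
    have "(\<Sum>u<K. if \<forall>h\<in>H - {e}. real K * (\<Sum>j\<in>(e - {i}) \<inter> - h. real (n j)) + real u < a m h
              then real (\<Prod>j\<in>e - {i}. cell_size K u (n j)) else 0)
        \<le> (\<Sum>u<K. real (\<Prod>j\<in>e - {i}. cell_size K u (n j)))"
      by (intro sum_mono) (auto simp del: of_nat_prod)
    also have "\<dots> \<le> real K ^ Suc (card (e - {i})) * (1 / real (Suc (card {j \<in> e - {i}. n j = 0})) + 1 / real K)"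
      using fine K by (intro sum_prod_cell_size) auto
    also have "Suc (card (e - {i})) = card e" using fine i by (rule card_Suc_Diff1)
    also have "Suc (card {j \<in> e - {i}. n j = 0}) = card (zeros (pt (m, n)))"
      using fine by (simp add: zeros_pt)
    finally show ?thesis using True by simp
  next
    case False
    then have "(\<Sum>u<K. if \<forall>h\<in>H - {e}. real K * (\<Sum>j\<in>(e - {i}) \<inter> - h. real (n j)) + real u < a m h
              then real (\<Prod>j\<in>e - {i}. cell_size K u (n j)) else 0) = 0"
      using iso[OF m n] by (intro sum.neutral) auto
    then show ?thesis using False by simp
  qed
  have "real K * real (card (face_cell e i))
      \<le> real K ^ card (V - e) * (\<Sum>m\<in>?M. \<Sum>u<K. \<Sum>x\<in>(e - {i}) \<rightarrow>\<^sub>E {..<K * D}.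
            if \<forall>h\<in>H - {e}. (\<Sum>j\<in>(e - {i}) \<inter> - h. real (x j)) + real u < a m h then 1 else 0)"
    using card_face_cell_inside_le[OF e i] by (simp add: a_def)
  also have "\<dots> \<le> real K ^ card (V - e) * (\<Sum>m\<in>?M. \<Sum>u<K. \<Sum>n\<in>?N.
            if \<forall>h\<in>H - {e}. real K * (\<Sum>j\<in>(e - {i}) \<inter> - h. real (n j)) + real u < a m h
              then real (\<Prod>j\<in>e - {i}. cell_size K u (n j)) else 0)"
    using fine K by (intro mult_left_mono sum_mono rounding) auto
  also have "\<dots> = real K ^ card (V - e) * (\<Sum>m\<in>?M. \<Sum>n\<in>?N. \<Sum>u<K.
            if \<forall>h\<in>H - {e}. real K * (\<Sum>j\<in>(e - {i}) \<inter> - h. real (n j)) + real u < a m h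
              then real (\<Prod>j\<in>e - {i}. cell_size K u (n j)) else 0)"
    by (subst sum.swap) (rule refl)
  also have "\<dots> \<le> real K ^ card (V - e) * (\<Sum>m\<in>?M. \<Sum>n\<in>?N. if pt (m, n) \<in> ?W then real K ^ card e * ?\<omega> (pt (m, n)) else 0)"
    by (intro mult_left_mono sum_mono bound) auto
  also have "(\<Sum>m\<in>?M. \<Sum>n\<in>?N. if pt (m, n) \<in> ?W then real K ^ card e * ?\<omega> (pt (m, n)) else 0)
      = (\<Sum>p\<in>{p \<in> ?M \<times> ?N. pt p \<in> ?W}. real K ^ card e * ?\<omega> (pt p))"
    using finM finN by (subst sum.inter_filter) (auto simp: sum.cartesian_product case_prod_unfold cong: if_cong)
  also have "\<dots> \<le> (\<Sum>w\<in>?W. real K ^ card e * ?\<omega> w)"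
  proof -
    have "inj_on pt {p \<in> ?M \<times> ?N. pt p \<in> ?W}"
    proof (rule inj_onI)
      fix p q assume p: "p \<in> {p \<in> ?M \<times> ?N. pt p \<in> ?W}" and q: "q \<in> {p \<in> ?M \<times> ?N. pt p \<in> ?W}" and eq: "pt p = pt q"
      obtain m n m' n' where pq: "p = (m, n)" "q = (m', n')" by (metis surj_pair)
      have "m = m'"
      proof (rule PiE_ext)
        show "m \<in> ?M" "m' \<in> ?M" using p q pq by auto
        fix j assume j: "j \<in> V - e"
        have "pt (m, n) j = pt (m', n') j" using eq pq by simp
        then show "m j = m' j" using j i by (auto simp: pt_def split: if_splits)
      qed
      moreover have "n = n'"
      proof (rule PiE_ext)
        show "n \<in> ?N" "n' \<in> ?N" using p q pq by auto
        fix j assume j: "j \<in> e - {i}"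
        have "pt (m, n) j = pt (m', n') j" using eq pq by simp
        then show "n j = n' j" using j eV by (auto simp: pt_def split: if_splits)
      qed
      ultimately show "p = q" using pq by simp
    qed
    then have "(\<Sum>p\<in>{p \<in> ?M \<times> ?N. pt p \<in> ?W}. real K ^ card e * ?\<omega> (pt p))
        = (\<Sum>w\<in>pt ` {p \<in> ?M \<times> ?N. pt p \<in> ?W}. real K ^ card e * ?\<omega> w)"
      by (simp add: sum.reindex)
    also have "\<dots> \<le> (\<Sum>w\<in>?W. real K ^ card e * ?\<omega> w)"
      using finW by (intro sum_mono2) auto
    finally show ?thesis .
  qed
  finally have "real K * real (card (face_cell e i)) \<le> real K ^ card (V - e) * (real K ^ card e * (\<Sum>w\<in>?W. ?\<omega> w))"
    by (simp add: sum_distrib_left mult_left_mono)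
  also have "\<dots> = real K ^ card V * (\<Sum>w\<in>?W. ?\<omega> w)"
  proof -
    have "card V = card (V - e) + card e" using finV eV by (metis add.commute card_Diff_subset card_mono fine le_add_diff_inverse)
    then show ?thesis by (simp add: power_add mult.assoc)
  qed
  also have "\<dots> = real K * (real K ^ (card V - 1) * (\<Sum>w\<in>?W. ?\<omega> w))"
  proof -
    have "card V > 0" using i eV finV by (auto simp: card_gt_0_iff)
    then show ?thesis by (cases "card V") auto
  qed
  finally show ?thesis using K by simp
qed

text \<open>A lattice point with \<open>z\<close> zeros, all in \<open>e\<close>, is charged
  \<open>1 / z + 1 / K\<close> by each of \<open>z\<close> faces, in total at most
  \<open>1 + card V / K\<close>. A point with a zero off \<open>e\<close> is charged at most once,
  by the face of its only zero off \<open>e\<close>. The two classes are disjoint.\<close>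

lemma sum_card_face_cell:
  assumes e: "e \<in> H"
  shows "(\<Sum>i\<in>V. real (card (face_cell e i)))
      \<le> real K ^ (card V - 1) * ((1 + real (card V) / real K) * real (card {w \<in> isolated_by e. zeros w \<noteq> {}}))"
proof -
  have eV: "e \<subseteq> V" using HV e by auto
  let ?c = "1 + real (card V) / real K"
  let ?In = "{w \<in> isolated_by e. zeros w \<noteq> {} \<and> zeros w \<subseteq> e}"
  let ?Out = "{w \<in> isolated_by e. \<not> zeros w \<subseteq> e}"
  let ?\<omega> = "\<lambda>w. 1 / real (card (zeros w)) + 1 / real K"
  have "(\<Sum>i\<in>e. \<Sum>w | w \<in> isolated_by e \<and> i \<in> zeros w \<and> zeros w \<subseteq> e. ?\<omega> w)
      = (\<Sum>i\<in>e. \<Sum>w | w \<in> ?In \<and> i \<in> zeros w. ?\<omega> w)"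
    by (intro sum.cong) auto
  also have "\<dots> = (\<Sum>w\<in>?In. \<Sum>i | i \<in> e \<and> i \<in> zeros w. ?\<omega> w)"
    using finite_isolated_by finite_edge[OF e] by (intro sum.swap_restrict) auto
  also have "\<dots> \<le> (\<Sum>w\<in>?In. ?c)"
  proof (rule sum_mono)
    fix w assume w: "w \<in> ?In"
    then have "{i. i \<in> e \<and> i \<in> zeros w} = zeros w" by auto
    moreover have "card (zeros w) > 0" using w finite_zeros by (simp add: card_gt_0_iff)
    moreover have "card (zeros w) \<le> card V" using finV by (intro card_mono) (auto simp: zeros_def)
    ultimately show "(\<Sum>i | i \<in> e \<and> i \<in> zeros w. ?\<omega> w) \<le> ?c"
      by (simp add: distrib_left divide_right_mono)
  qed
  finally have in_le: "(\<Sum>i\<in>e. \<Sum>w | w \<in> isolated_by e \<and> i \<in> zeros w \<and> zeros w \<subseteq> e. ?\<omega> w) \<le> ?c * real (card ?In)"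
    by (simp add: mult.commute)
  have "(\<Sum>i\<in>V - e. card {w \<in> isolated_by e. zeros w - e = {i}})
      = card (\<Union>i\<in>V - e. {w \<in> isolated_by e. zeros w - e = {i}})"
    using finV finite_isolated_by by (intro card_UN_disjoint[symmetric]) auto
  also have "\<dots> \<le> card ?Out" using finite_isolated_by by (intro card_mono) auto
  finally have out_le: "(\<Sum>i\<in>V - e. card {w \<in> isolated_by e. zeros w - e = {i}}) \<le> card ?Out" .
  have "(\<Sum>i\<in>V. real (card (face_cell e i))) = (\<Sum>i\<in>e. real (card (face_cell e i))) + (\<Sum>i\<in>V - e. real (card (face_cell e i)))"
    using finV eV by (metis add.commute sum.subset_diff)
  also have "(\<Sum>i\<in>e. real (card (face_cell e i))) \<le> real K ^ (card V - 1) * (?c * real (card ?In))"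
  proof -
    have "(\<Sum>i\<in>e. real (card (face_cell e i)))
        \<le> (\<Sum>i\<in>e. real K ^ (card V - 1) * (\<Sum>w | w \<in> isolated_by e \<and> i \<in> zeros w \<and> zeros w \<subseteq> e. ?\<omega> w))"
      by (intro sum_mono card_face_cell_inside e)
    also have "\<dots> = real K ^ (card V - 1) * (\<Sum>i\<in>e. \<Sum>w | w \<in> isolated_by e \<and> i \<in> zeros w \<and> zeros w \<subseteq> e. ?\<omega> w)"
      by (simp only: sum_distrib_left)
    also have "\<dots> \<le> real K ^ (card V - 1) * (?c * real (card ?In))"
      using in_le by (intro mult_left_mono) auto
    finally show ?thesis .
  qed
  also have "(\<Sum>i\<in>V - e. real (card (face_cell e i))) \<le> real K ^ (card V - 1) * (?c * real (card ?Out))"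
  proof -
    have "(\<Sum>i\<in>V - e. card (face_cell e i)) \<le> (\<Sum>i\<in>V - e. K ^ (card V - 1) * card {w \<in> isolated_by e. zeros w - e = {i}})"
      by (intro sum_mono card_face_cell_outside e)
    also have "\<dots> \<le> K ^ (card V - 1) * card ?Out"
      using out_le by (simp flip: sum_distrib_left)
    finally have "(\<Sum>i\<in>V - e. real (card (face_cell e i))) \<le> real (K ^ (card V - 1) * card ?Out)"
      by (simp only: of_nat_le_iff flip: of_nat_sum)
    also have "\<dots> \<le> real K ^ (card V - 1) * (?c * real (card ?Out))"
      by (simp add: mult_left_mono mult_right_mono[of 1 ?c, simplified])
    finally show ?thesis .
  qed
  finally have "(\<Sum>i\<in>V. real (card (face_cell e i)))
      \<le> real K ^ (card V - 1) * (?c * (real (card ?In) + real (card ?Out)))"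
    by (simp add: distrib_left)
  also have "real (card ?In) + real (card ?Out) = real (card {w \<in> isolated_by e. zeros w \<noteq> {}})"
  proof -
    have "{w \<in> isolated_by e. zeros w \<noteq> {}} = ?In \<union> ?Out" "?In \<inter> ?Out = {}" by auto
    then show ?thesis using finite_isolated_by by (simp add: card_Un_disjoint)
  qed
  finally show ?thesis .
qed

section \<open>From the cells of single edges to the whole shell\<close>

lemma isolating_if_isolated_by: "e \<in> H \<Longrightarrow> w \<in> isolated_by e \<Longrightarrow> isolating H f w"
  unfolding isolating_def
proof (rule ex1I[of _ e])
  assume e: "e \<in> H" and w: "w \<in> isolated_by e"
  then have less: "edge_weight f w e < edge_weight f w h" if "h \<in> H" "h \<noteq> e" for h
    using that by (simp add: isolated_by_def)
  show "e \<in> H \<and> (\<forall>h\<in>H. edge_weight f w e \<le> edge_weight f w h)"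
    using e less by (metis less_imp_le order_refl)
  show "h = e" if "h \<in> H \<and> (\<forall>g\<in>H. edge_weight f w h \<le> edge_weight f w g)" for h
    using that e less[of h] by (metis not_le)
qed

lemma isolated_by_disjoint:
  assumes "e \<in> H" "h \<in> H" "e \<noteq> h"
  shows "isolated_by e \<inter> isolated_by h = {}"
proof -
  have False if "w \<in> isolated_by e" "w \<in> isolated_by h" for w
  proof -
    have "edge_weight f w e < edge_weight f w h" "edge_weight f w h < edge_weight f w e"
      using that assms by (simp_all add: isolated_by_def)
    then show False by simp
  qed
  then show ?thesis by auto
qed

text \<open>Every grid cell of a face belongs to some edge, namely one of minimum weight at its
  centre, so the \<open>(K * D) ^ (card V - 1)\<close> cells of each face are all counted. The
  lattice points isolated by different edges are different.\<close>

lemma shell_bound_grid: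
  assumes "H \<noteq> {}"
  shows "real (card V * D ^ (card V - 1)) \<le> (1 + real (card V) / real K)
      * real (card {w \<in> V \<rightarrow>\<^sub>E {..D}. isolating H f w \<and> (\<exists>j\<in>V. w j = 0)})"
proof -
  let ?c = "1 + real (card V) / real K"
  let ?I = "{w \<in> V \<rightarrow>\<^sub>E {..D}. isolating H f w \<and> (\<exists>j\<in>V. w j = 0)}"
  let ?U = "\<lambda>e. {w \<in> isolated_by e. zeros w \<noteq> {}}"
  have face: "(K * D) ^ (card V - 1) \<le> (\<Sum>e\<in>H. card (face_cell e i))" if i: "i \<in> V" for i
  proof -
    have "(V - {i}) \<rightarrow>\<^sub>E {..<K * D} \<subseteq> (\<Union>e\<in>H. face_cell e i)"
    proof
      fix X assume X: "X \<in> (V - {i}) \<rightarrow>\<^sub>E {..<K * D}"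
      obtain e where "is_arg_min (edge_weight (\<lambda>e. 2 * real K * f e) (face_point i X)) (\<lambda>e. e \<in> H) e"
        using ex_is_arg_min_if_finite[OF finite_H assms] by blast
      then show "X \<in> (\<Union>e\<in>H. face_cell e i)"
        using X by (auto simp: face_cell_def is_arg_min_linorder)
    qed
    moreover have "finite (face_cell e i)" for e
      unfolding face_cell_def using finV by (simp add: finite_PiE)
    ultimately have "card ((V - {i}) \<rightarrow>\<^sub>E {..<K * D}) \<le> card (\<Union>e\<in>H. face_cell e i)"
      using finite_H by (intro card_mono) auto
    also have "\<dots> \<le> (\<Sum>e\<in>H. card (face_cell e i))" by (rule card_UN_le[OF finite_H])
    finally show ?thesis using finV i by (simp add: card_PiE)
  qed
  have "(\<Sum>e\<in>H. card (?U e)) = card (\<Union>e\<in>H. ?U e)"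
    using finite_H finite_isolated_by isolated_by_disjoint
    by (intro card_UN_disjoint[symmetric]) auto
  also have "\<dots> \<le> card ?I"
    using finV isolating_if_isolated_by
    by (intro card_mono) (auto simp: finite_PiE isolated_by_def zeros_def)
  finally have U: "(\<Sum>e\<in>H. card (?U e)) \<le> card ?I" .
  have "real K ^ (card V - 1) * real (card V * D ^ (card V - 1)) = (\<Sum>i\<in>V. real ((K * D) ^ (card V - 1)))"
    by (simp add: power_mult_distrib)
  also have "\<dots> \<le> (\<Sum>i\<in>V. real (\<Sum>e\<in>H. card (face_cell e i)))"
    using face by (intro sum_mono of_nat_mono)
  also have "\<dots> = (\<Sum>e\<in>H. \<Sum>i\<in>V. real (card (face_cell e i)))"
    by (simp only: of_nat_sum) (rule sum.swap)
  also have "\<dots> \<le> (\<Sum>e\<in>H. real K ^ (card V - 1) * (?c * real (card (?U e))))"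
    by (intro sum_mono sum_card_face_cell)
  also have "\<dots> = real K ^ (card V - 1) * (?c * real (\<Sum>e\<in>H. card (?U e)))"
    by (simp only: sum_distrib_left of_nat_sum)
  also have "\<dots> \<le> real K ^ (card V - 1) * (?c * real (card ?I))"
    using U by (intro mult_left_mono of_nat_mono) auto
  finally show ?thesis using K by (simp del: of_nat_mult of_nat_power)
qed

end

lemma shell_bound:
  assumes "finite V" "H \<subseteq> Pow V" "inclusion_free H" "H \<noteq> {}"
  shows "card V * D ^ (card V - 1) \<le> card {w \<in> V \<rightarrow>\<^sub>E {..D}. isolating H f w \<and> (\<exists>j\<in>V. w j = 0)}"
    (is "?l \<le> card ?I")
proof -
  \<comment> \<open>Large enough for the error \<open>card V / K * card ?I\<close> to be below 1, so
    that integrality removes it.\<close>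
  define K where "K = card V * card ?I + 1"
  interpret shell V H f K D using assms by unfold_locales (auto simp: K_def)
  have "real (card V) * real (card ?I) < real K" unfolding K_def by simp
  then have "real (card V) / real K * real (card ?I) < 1" using K by (simp add: field_simps)
  then have "real ?l < real (card ?I) + 1" using shell_bound_grid[OF assms(4)]
    by (simp only: distrib_right)
  then show ?thesis by linarith
qed

section \<open>Summing over the shells\<close>

lemma edge_weight_shift:
  assumes "e \<subseteq> V" "finite V"
  shows "edge_weight f (\<lambda>i\<in>V. w i + c) e = edge_weight (\<lambda>e. f e + real c * real (card e)) w e"
proof -
  have "(\<Sum>i\<in>e. real ((\<lambda>i\<in>V. w i + c) i)) = (\<Sum>i\<in>e. real (w i) + real c)"
    using assms by (intro sum.cong) auto
  then show ?thesis by (simp add: edge_weight_def sum.distrib)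
qed

text \<open>Adding \<open>c\<close> to all weights adds \<open>c * card e\<close> to the weight of
  \<open>e\<close>, and an arbitrary \<open>f\<close> can absorb this.\<close>

lemma isolating_shift:
  assumes "H \<subseteq> Pow V" "finite V"
  shows "isolating H f (\<lambda>i\<in>V. w i + c) \<longleftrightarrow> isolating H (\<lambda>e. f e + real c * real (card e)) w"
proof -
  have "edge_weight f (\<lambda>i\<in>V. w i + c) e = edge_weight (\<lambda>e. f e + real c * real (card e)) w e" if "e \<in> H" for e
    using that assms by (intro edge_weight_shift) auto
  then show ?thesis by (simp add: isolating_def cong: conj_cong)
qed

lemma card_isolating_ge:
  assumes "finite V" "H \<subseteq> Pow V" "inclusion_free H" "H \<noteq> {}" "d \<ge> 1"
  shows "card V * (\<Sum>j=0..d-1. j ^ (card V - 1)) \<le> card {w \<in> V \<rightarrow>\<^sub>E {1..d}. isolating H f w}"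
proof -
  \<comment> \<open>The isolating assignments with minimum weight exactly \<open>d - j\<close>.
    Subtracting \<open>d - j\<close> turns them into points of the shell of side
    \<open>j\<close>.\<close>
  define S where "S j = {w \<in> V \<rightarrow>\<^sub>E {d - j..d}. isolating H f w \<and> (\<exists>i\<in>V. w i = d - j)}" for j
  have fin: "finite (S j)" for j unfolding S_def using assms by (simp add: finite_PiE)
  have shell: "card V * j ^ (card V - 1) \<le> card (S j)" if j: "j \<le> d - 1" for j
  proof -
    let ?f = "\<lambda>e. f e + real (d - j) * real (card e)"
    let ?I = "{w \<in> V \<rightarrow>\<^sub>E {..j}. isolating H ?f w \<and> (\<exists>i\<in>V. w i = 0)}"
    let ?s = "\<lambda>w. \<lambda>i\<in>V. w i + (d - j)"
    have "inj_on ?s ?I"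
    proof (rule inj_onI)
      fix w w' assume w: "w \<in> ?I" "w' \<in> ?I" and eq: "?s w = ?s w'"
      show "w = w'"
      proof (rule PiE_ext)
        show "w \<in> V \<rightarrow>\<^sub>E {..j}" "w' \<in> V \<rightarrow>\<^sub>E {..j}" using w by auto
        fix i assume "i \<in> V"
        then show "w i = w' i" using fun_cong[OF eq, of i] by simp
      qed
    qed
    moreover have "?s ` ?I \<subseteq> S j"
    proof (rule image_subsetI)
      fix w assume w: "w \<in> ?I"
      then have "w i \<le> j" if "i \<in> V" for i using that by (auto simp: PiE_iff)
      then have "?s w \<in> V \<rightarrow>\<^sub>E {d - j..d}" using j assms(5) by fastforce
      moreover have "isolating H f (?s w)" using w isolating_shift[OF assms(2,1)] by blast
      ultimately show "?s w \<in> S j" using w by (auto simp: S_def)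
    qed
    ultimately have "card ?I \<le> card (S j)" using fin by (intro card_inj_on_le)
    then show ?thesis using shell_bound[OF assms(1-4), of j ?f] by linarith
  qed
  have disj: "S j \<inter> S k = {}" if "j \<le> d - 1" "k \<le> d - 1" "j < k" for j k
  proof -
    have False if "w \<in> S j" "w \<in> S k" for w
    proof -
      obtain i where i: "i \<in> V" "w i = d - k" using \<open>w \<in> S k\<close> by (auto simp: S_def)
      then have "d - j \<le> d - k" using \<open>w \<in> S j\<close> by (auto simp: S_def PiE_iff)
      then show False using \<open>j < k\<close> \<open>k \<le> d - 1\<close> assms(5) by linarith
    qed
    then show ?thesis by auto
  qed
  have "card V * (\<Sum>j=0..d-1. j ^ (card V - 1)) \<le> (\<Sum>j=0..d-1. card (S j))"
    unfolding sum_distrib_left using shell by (intro sum_mono) auto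
  also have "\<dots> = card (\<Union>j\<in>{0..d-1}. S j)"
  proof (rule card_UN_disjoint[symmetric])
    show "\<forall>j\<in>{0..d-1}. \<forall>k\<in>{0..d-1}. j \<noteq> k \<longrightarrow> S j \<inter> S k = {}"
      using disj by (metis Int_commute atLeastAtMost_iff linorder_neqE_nat)
  qed (use fin in auto)
  also have "\<dots> \<le> card {w \<in> V \<rightarrow>\<^sub>E {1..d}. isolating H f w}"
  proof (rule card_mono)
    show "(\<Union>j\<in>{0..d-1}. S j) \<subseteq> {w \<in> V \<rightarrow>\<^sub>E {1..d}. isolating H f w}"
    proof (rule UN_least)
      fix j assume "j \<in> {0..d-1}"
      then have "{d - j..d} \<subseteq> {1..d}" using assms(5) by auto
      then have "V \<rightarrow>\<^sub>E {d - j..d} \<subseteq> V \<rightarrow>\<^sub>E {1..d}" by (intro PiE_mono) auto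
      then show "S j \<subseteq> {w \<in> V \<rightarrow>\<^sub>E {1..d}. isolating H f w}" by (auto simp: S_def)
    qed
  qed (use assms in \<open>simp add: finite_PiE\<close>)
  finally show ?thesis .
qed

section \<open>The singleton hypergraph\<close>

lemma isolating_singleton_iff:
  "isolating (singleton_hypergraph n) (\<lambda>_. 0) w \<longleftrightarrow> (\<exists>i\<in>{1..n}. \<forall>k\<in>{1..n} - {i}. w i < w k)"
proof -
  have ew: "edge_weight (\<lambda>_. 0) w {i} = real (w i)" for i by (simp add: edge_weight_def)
  show ?thesis
  proof
    assume "isolating (singleton_hypergraph n) (\<lambda>_. 0) w"
    then obtain i where i: "i \<in> {1..n}" "\<forall>k\<in>{1..n}. w i \<le> w k"
      and uniq: "\<And>h. h \<in> singleton_hypergraph n \<Longrightarrow>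
        \<forall>g\<in>singleton_hypergraph n. edge_weight (\<lambda>_. 0) w h \<le> edge_weight (\<lambda>_. 0) w g \<Longrightarrow> h = {i}"
      unfolding isolating_def by (elim ex1E) (auto simp: singleton_hypergraph_def ew)
    have "w i < w k" if k: "k \<in> {1..n} - {i}" for k
    proof (rule ccontr)
      assume "\<not> w i < w k"
      then have "{k} = {i}" using i k by (intro uniq) (force simp: singleton_hypergraph_def ew)+
      then show False using k by auto
    qed
    then show "\<exists>i\<in>{1..n}. \<forall>k\<in>{1..n} - {i}. w i < w k" using i by blast
  next
    assume "\<exists>i\<in>{1..n}. \<forall>k\<in>{1..n} - {i}. w i < w k"
    then obtain i where i: "i \<in> {1..n}" "\<And>k. k \<in> {1..n} \<Longrightarrow> k \<noteq> i \<Longrightarrow> w i < w k" by blast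
    then have le: "w i \<le> w k" if "k \<in> {1..n}" for k using that by (cases "k = i") (auto intro: less_imp_le)
    show "isolating (singleton_hypergraph n) (\<lambda>_. 0) w"
      unfolding isolating_def
    proof (rule ex1I[of _ "{i}"])
      show "{i} \<in> singleton_hypergraph n \<and>
        (\<forall>h\<in>singleton_hypergraph n. edge_weight (\<lambda>_. 0) w {i} \<le> edge_weight (\<lambda>_. 0) w h)"
        using i le by (auto simp: singleton_hypergraph_def ew)
    next
      fix h assume h: "h \<in> singleton_hypergraph n \<and>
        (\<forall>g\<in>singleton_hypergraph n. edge_weight (\<lambda>_. 0) w h \<le> edge_weight (\<lambda>_. 0) w g)"
      then obtain k where k: "h = {k}" "k \<in> {1..n}" by (auto simp: singleton_hypergraph_def)
      then have "w k \<le> w i" using h i(1) by (auto simp: singleton_hypergraph_def ew)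
      then show "h = {i}" using i(2)[of k] k by force
    qed
  qed
qed

lemma card_isolating_singleton:
  assumes "d \<ge> 1"
  shows "card {w \<in> weight_assignments n d. isolating (singleton_hypergraph n) (\<lambda>_. 0) w}
       = n * (\<Sum>j=0..d-1. j ^ (n-1))"
proof -
  \<comment> \<open>The functions with strict minimum \<open>c\<close> at \<open>i\<close>: every
    other coordinate has \<open>d - c\<close> free values.\<close>
  define S where "S = (\<lambda>(i, c). PiE {1..n} (\<lambda>k. if k = i then {c} else {c<..d}))"
  have eq: "{w \<in> weight_assignments n d. isolating (singleton_hypergraph n) (\<lambda>_. 0) w}
      = (\<Union>p\<in>{1..n} \<times> {1..d}. S p)" (is "?L = ?R")
  proof (intro subset_antisym subsetI)
    fix w assume "w \<in> ?L"
    then obtain i where w: "w \<in> {1..n} \<rightarrow>\<^sub>E {1..d}" and i: "i \<in> {1..n}" "\<forall>k\<in>{1..n} - {i}. w i < w k"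
      unfolding weight_assignments_def isolating_singleton_iff by blast
    then have "w \<in> S (i, w i)" by (auto simp: S_def PiE_iff)
    moreover have "w i \<in> {1..d}" using w i by blast
    ultimately show "w \<in> ?R" using i(1) by blast
  next
    fix w assume "w \<in> ?R"
    then obtain i c where ic: "i \<in> {1..n}" "c \<in> {1..d}" and w: "w \<in> S (i, c)" by auto
    have wi: "w i = c" and wk: "\<And>k. k \<in> {1..n} \<Longrightarrow> k \<noteq> i \<Longrightarrow> c < w k \<and> w k \<le> d"
      using w ic by (auto simp: S_def PiE_iff split: if_splits)
    have "w k \<in> {1..d}" if "k \<in> {1..n}" for k
      using that wi wk[of k] ic by (cases "k = i") auto
    then have "w \<in> {1..n} \<rightarrow>\<^sub>E {1..d}" using w by (simp add: S_def PiE_iff)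
    then show "w \<in> ?L"
      using ic(1) wi wk unfolding weight_assignments_def isolating_singleton_iff by blast
  qed
  have disj: "S p \<inter> S q = {}" if p: "p \<in> {1..n} \<times> {1..d}" and q: "q \<in> {1..n} \<times> {1..d}" and "p \<noteq> q" for p q
  proof -
    obtain i c k b where pq: "p = (i, c)" "q = (k, b)" by (metis surj_pair)
    have False if w: "w \<in> S p" "w \<in> S q" for w
    proof -
      have wc: "w i = c" "w k = b" using w pq p q by (auto simp: S_def PiE_iff split: if_splits)
      then have ne: "i \<noteq> k" using \<open>p \<noteq> q\<close> pq by auto
      have "w i < w k" using w(1) pq q p ne wc by (force simp: S_def PiE_iff)
      moreover have "w k < w i" using w(2) pq q p ne wc by (force simp: S_def PiE_iff)
      ultimately show False by simp
    qed
    then show ?thesis by auto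
  qed
  have card_S: "card (S (i, c)) = (d - c) ^ (n - 1)" if i: "i \<in> {1..n}" for i c
  proof -
    have "(\<Prod>k\<in>{1..n}. card (if k = i then {c} else {c<..d})) = (\<Prod>k\<in>{1..n} - {i}. card (if k = i then {c} else {c<..d}))"
      using i by (subst prod.remove[of _ i]) auto
    also have "\<dots> = (\<Prod>k\<in>{1..n} - {i}. d - c)" by (intro prod.cong) auto
    finally show ?thesis using i by (simp add: S_def card_PiE)
  qed
  have "card ?L = (\<Sum>p\<in>{1..n} \<times> {1..d}. card (S p))"
    unfolding eq using disj by (intro card_UN_disjoint) (auto simp: S_def finite_PiE)
  also have "\<dots> = (\<Sum>i\<in>{1..n}. \<Sum>c\<in>{1..d}. card (S (i, c)))"
    by (simp add: sum.cartesian_product)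
  also have "\<dots> = (\<Sum>i\<in>{1..n}. \<Sum>c\<in>{1..d}. (d - c) ^ (n - 1))"
    using card_S by (intro sum.cong) auto
  also have "\<dots> = n * (\<Sum>c\<in>{1..d}. (d - c) ^ (n - 1))" by simp
  \<comment> \<open>The substitution is \<open>j = d - c\<close>. For \<open>n = 1\<close> the term
    \<open>c = d\<close> is \<open>0 ^ 0 = 1\<close>, as there are no other coordinates to
    choose.\<close>
  also have "(\<Sum>c\<in>{1..d}. (d - c) ^ (n - 1)) = (\<Sum>j=0..d-1. j ^ (n - 1))"
    by (rule sum.reindex_bij_witness[of _ "\<lambda>j. d - j" "\<lambda>c. d - c"]) (use assms in auto)
  finally show ?thesis .
qed

theorem theorem1:
  fixes d n :: nat
  assumes "d \<ge> 1" and "n \<ge> 1"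
  shows "(\<forall>(H :: nat set set) (f :: nat set \<Rightarrow> real).
            hypergraph_on n H \<and> H \<noteq> {} \<and> inclusion_free H \<longrightarrow>
            card {w \<in> weight_assignments n d. isolating H f w} \<ge> n * (\<Sum>j=0..d-1. j ^ (n-1)))
       \<and> (hypergraph_on n (singleton_hypergraph n) \<and> singleton_hypergraph n \<noteq> {}
            \<and> inclusion_free (singleton_hypergraph n)
            \<and> card {w \<in> weight_assignments n d. isolating (singleton_hypergraph n) (\<lambda>_. 0) w}
               = n * (\<Sum>j=0..d-1. j ^ (n-1)))"
proof (intro conjI allI impI)
  fix H :: "nat set set" and f :: "nat set \<Rightarrow> real"
  assume H: "hypergraph_on n H \<and> H \<noteq> {} \<and> inclusion_free H"
  show "card {w \<in> weight_assignments n d. isolating H f w} \<ge> n * (\<Sum>j=0..d-1. j ^ (n-1))"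
    using card_isolating_ge[of "{1..n}" H d f] H assms
    by (simp add: hypergraph_on_def weight_assignments_def)
next
  show "hypergraph_on n (singleton_hypergraph n)" "singleton_hypergraph n \<noteq> {}"
    "inclusion_free (singleton_hypergraph n)"
    using assms by (auto simp: hypergraph_on_def singleton_hypergraph_def inclusion_free_def)
  show "card {w \<in> weight_assignments n d. isolating (singleton_hypergraph n) (\<lambda>_. 0) w}
      = n * (\<Sum>j=0..d-1. j ^ (n-1))"
    using assms by (intro card_isolating_singleton)
qed

end
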